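(* Let $G$ be a graph of order $n\geqslant 5$, and let $\overline{G}$ be its complement. Then: (1) if $n=5$ or $n$ is even, then $n\leqslant \chi_i(G)+\chi_i(\overline{G})\leqslant 2n$; (2) if $n\geqslant 7$ is odd, then $n+1\leqslant \chi_i(G)+\chi_i(\overline{G})\leqslant 2n$.
   Context: All graphs are finite and simple; the order of a graph is its number of vertices, and $\overline{G}$ denotes the complement of $G$. A mapping $f:V(G)\to\{1,\ldots,k\}$ is an injective $k$-coloring of $G$ if $f(u)\neq f(v)$ whenever the distinct vertices $u$ and $v$ have a common neighbor in $G$ (adjacent vertices without a common neighbor may receive the same color). The injective chromatic number $\chi_i(G)$ is the minimum $k$ such that $G$ has an injective $k$-coloring. *)

theory Defs
  imports "Graph_Theory.Pair_Digraph" "HOL-Library.FuncSet"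
begin

text \<open>
  A finite simple graph is a \<open>pair_graph\<close>: a finite set of vertices with a symmetric,
  loop-free arc relation, each undirected edge being stored as two opposite arcs.
\<close>

definition complement_graph :: "'a pair_pre_digraph \<Rightarrow> 'a pair_pre_digraph" where
  "complement_graph G =
    \<lparr> pverts = pverts G,
      parcs = {(u, v). u \<in> pverts G \<and> v \<in> pverts G \<and> u \<noteq> v \<and> (u, v) \<notin> parcs G} \<rparr>"

definition common_neighbor :: "'a pair_pre_digraph \<Rightarrow> 'a \<Rightarrow> 'a \<Rightarrow> bool" where
  "common_neighbor G u v \<longleftrightarrow> (\<exists>w \<in> pverts G. (u, w) \<in> parcs G \<and> (v, w) \<in> parcs G)"

definition injective_coloring :: "'a pair_pre_digraph \<Rightarrow> nat \<Rightarrow> ('a \<Rightarrow> nat) \<Rightarrow> bool" where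
  "injective_coloring G k f \<longleftrightarrow>
    f \<in> pverts G \<rightarrow> {1..k} \<and>
    (\<forall>u \<in> pverts G. \<forall>v \<in> pverts G. u \<noteq> v \<and> common_neighbor G u v \<longrightarrow> f u \<noteq> f v)"

definition injective_chromatic_number :: "'a pair_pre_digraph \<Rightarrow> nat" where
  "injective_chromatic_number G = (LEAST k. \<exists>f. injective_coloring G k f)"

lemma pair_graph_complement_graph:
  assumes "pair_graph G"
  shows "pair_graph (complement_graph G)"
proof -
  interpret pair_graph G by (rule assms)
  have sym: "(u, v) \<in> parcs G \<longleftrightarrow> (v, u) \<in> parcs G" for u v
    using pair_sym_arcs by (auto simp: symmetric_def dest: symD)
  have fin: "finite (parcs (complement_graph G))"
    by (rule finite_subset[of _ "pverts G \<times> pverts G"]) (auto simp: complement_graph_def)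
  show ?thesis
    using fin sym by unfold_locales (auto simp: complement_graph_def symmetric_def sym_def)
qed

text \<open>The set of admissible numbers of colors is nonempty, so the minimum is attained.\<close>

lemma injective_coloring_exists:
  assumes "finite (pverts G)"
  shows "\<exists>f. injective_coloring G (card (pverts G)) f"
proof -
  obtain h where "bij_betw h (pverts G) {1..card (pverts G)}"
    using finite_same_card_bij[OF assms, of "{1..card (pverts G)}"]
    by auto
  then have "injective_coloring G (card (pverts G)) h"
    by (auto simp: injective_coloring_def bij_betw_def inj_on_def)
  then show ?thesis by blast
qed

end

theory Submission
  imports Defs
begin

text \<open>
  If \<open>f\<close> is an injective coloring of \<open>G\<close> with \<open>k\<close> colors, then the neighbors of any vertex have
  distinct colors, so all degrees are at most \<open>k\<close>, and the neighborhoods of the vertices of one color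
  class are pairwise disjoint. With \<open>l\<close> colors for the complement, \<open>k + l \<ge> n - 1\<close> follows from
  \<open>deg v + deg' v = n - 1\<close>. Suppose \<open>k \<le> l\<close> and that \<open>k + l\<close> is below the claimed bound. Two vertices
  of equal color in the complement dominate all others in \<open>G\<close>, so \<open>n - 2 \<le> 2 k\<close>; thus all degrees are
  about \<open>n / 2\<close>, while some color class \<open>A\<close> of \<open>G\<close> has at least three vertices. Disjointness of
  neighborhoods forces \<open>A\<close> to have exactly three vertices. As \<open>G\<close> is a matching on \<open>A\<close>, some \<open>x \<in> A\<close>
  has no neighbor in \<open>A\<close>, hence less than full degree in \<open>G\<close>, hence full degree \<open>l\<close> in the complement,
  and so a neighbor \<open>y\<close> there with the same complement color. The pair \<open>x, y\<close> dominates \<open>G\<close>, so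
  \<open>y \<in> A\<close>, and the third vertex of \<open>A\<close> is left with degree at most one.
\<close>

section \<open>Degrees and color classes in one colored graph\<close>

locale injectively_colored_graph =
  fixes V :: "'a set" and E :: "'a \<Rightarrow> 'a \<Rightarrow> bool" and f :: "'a \<Rightarrow> nat" and k :: nat
  assumes finite_V: "finite V"
    and sym: "E u v \<Longrightarrow> E v u"
    and irrefl: "\<not> E v v"
    and color_range: "v \<in> V \<Longrightarrow> f v \<in> {1..k}"
    and proper: "\<lbrakk>u \<in> V; v \<in> V; w \<in> V; E u w; E v w; f u = f v\<rbrakk> \<Longrightarrow> u = v"
begin

definition nbrs :: "'a \<Rightarrow> 'a set" where
  "nbrs v = {w \<in> V. E v w}"

lemma finite_nbrs [simp]: "finite (nbrs v)"
  using finite_V by (simp add: nbrs_def)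

lemma inj_on_nbrs:
  assumes "v \<in> V" shows "inj_on f (nbrs v)"
proof (rule inj_onI)
  fix u w assume "u \<in> nbrs v" "w \<in> nbrs v" "f u = f w"
  then show "u = w" using assms proper[of u w v] sym[of v] by (simp add: nbrs_def)
qed

lemma degree_le:
  assumes "v \<in> V" shows "card (nbrs v) \<le> k"
proof -
  have "card (nbrs v) \<le> card {1..k}"
    using color_range by (intro card_inj_on_le[OF inj_on_nbrs[OF assms]]) (auto simp: nbrs_def)
  then show ?thesis by simp
qed

text \<open>The color \<open>f u\<close> lies in the range but is missing on the neighborhood.
  Contrapositively, a vertex of degree \<open>k\<close> has a neighbor of every color in use,
  including its own.\<close>

lemma degree_less:
  assumes v: "v \<in> V" and u: "u \<in> V" and none: "\<And>w. w \<in> V \<Longrightarrow> E v w \<Longrightarrow> f w \<noteq> f u"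
  shows "card (nbrs v) < k"
proof -
  have "card (nbrs v) \<le> card ({1..k} - {f u})"
    using color_range none
    by (intro card_inj_on_le[OF inj_on_nbrs[OF v]]) (auto simp: nbrs_def)
  also have "\<dots> < card {1..k}"
    using color_range[OF u] by (intro card_Diff1_less) auto
  finally show ?thesis by simp
qed

lemma sum_degree_eq:
  assumes A: "A \<subseteq> V" and mono: "\<forall>u\<in>A. \<forall>v\<in>A. f u = f v"
  shows "(\<Sum>v\<in>A. card (nbrs v)) = card (\<Union>v\<in>A. nbrs v)"
proof (rule card_UN_disjoint[symmetric])
  show "finite A" using A finite_V finite_subset by blast
  show "\<forall>u\<in>A. \<forall>v\<in>A. u \<noteq> v \<longrightarrow> nbrs u \<inter> nbrs v = {}"
    using A mono proper unfolding nbrs_def by blast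
qed simp

lemma sum_degree_le:
  assumes "A \<subseteq> V" and "\<forall>u\<in>A. \<forall>v\<in>A. f u = f v"
  shows "(\<Sum>v\<in>A. card (nbrs v)) \<le> card V"
  unfolding sum_degree_eq[OF assms] by (rule card_mono[OF finite_V]) (auto simp: nbrs_def)

text \<open>The vertex \<open>x\<close> lies outside all the disjoint neighborhoods being
  counted.\<close>

lemma sum_degree_less:
  assumes "A \<subseteq> V" and "\<forall>u\<in>A. \<forall>v\<in>A. f u = f v"
    and x: "x \<in> V" and none: "\<And>v. v \<in> A \<Longrightarrow> \<not> E x v"
  shows "(\<Sum>v\<in>A. card (nbrs v)) < card V"
proof -
  have "x \<notin> (\<Union>v\<in>A. nbrs v)" using none sym[of _ x] by (auto simp: nbrs_def)
  with x have "(\<Union>v\<in>A. nbrs v) \<subset> V" by (auto simp: nbrs_def)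
  then show ?thesis
    unfolding sum_degree_eq[OF assms(1,2)] by (rule psubset_card_mono[OF finite_V])
qed

lemma same_color_exists:
  assumes "k < card V"
  obtains u v where "u \<in> V" "v \<in> V" "u \<noteq> v" "f u = f v"
proof -
  have "\<not> inj_on f V"
  proof
    assume "inj_on f V"
    then have "card V \<le> card {1..k}"
      using color_range by (intro card_inj_on_le) auto
    with assms show False by simp
  qed
  with that show thesis unfolding inj_on_def by blast
qed

lemma large_class_exists:
  assumes "m * k < card V"
  obtains c where "m < card {v \<in> V. f v = c}"
proof (rule ccontr)
  assume "\<not> thesis"
  then have small: "card {v \<in> V. f v = c} \<le> m" for c
    using that not_le by blast
  have "card V \<le> card (\<Union>c\<in>{1..k}. {v \<in> V. f v = c})"
    using color_range finite_V by (intro card_mono) auto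
  also have "\<dots> \<le> (\<Sum>c\<in>{1..k}. card {v \<in> V. f v = c})"
    by (rule card_UN_le) simp
  also have "\<dots> \<le> m * k"
    using sum_bounded_above[of "{1..k}" "\<lambda>c. card {v \<in> V. f v = c}" m] small
    by (simp add: mult.commute)
  finally show False using assms by simp
qed

text \<open>A vertex joined to both others would be their common neighbor, so the triple spans at
  most one edge.\<close>

lemma isolated_in_triple:
  assumes "{p, q, r} \<subseteq> V" "p \<noteq> q" "p \<noteq> r" "q \<noteq> r" "f p = f q" "f q = f r"
  obtains x where "x \<in> {p, q, r}" "\<And>w. w \<in> {p, q, r} \<Longrightarrow> \<not> E x w"
proof -
  have "\<not> (E p q \<and> E p r)" "\<not> (E q p \<and> E q r)" "\<not> (E r p \<and> E r q)"
    using assms proper sym by (metis insert_subset)+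
  then have "\<exists>x\<in>{p, q, r}. \<forall>w\<in>{p, q, r}. \<not> E x w"
    using sym irrefl by blast
  with that show thesis by blast
qed

end

section \<open>A colored graph and its colored complement\<close>

locale injectively_colored_pair =
  G: injectively_colored_graph V E f k + H: injectively_colored_graph V F g l
  for V :: "'a set" and E F f g k l +
  assumes complement: "\<lbrakk>u \<in> V; v \<in> V; u \<noteq> v\<rbrakk> \<Longrightarrow> F u v \<longleftrightarrow> \<not> E u v"
begin

lemma degree_sum:
  assumes v: "v \<in> V"
  shows "card (G.nbrs v) + card (H.nbrs v) = card V - 1"
proof -
  have "G.nbrs v \<union> H.nbrs v = V - {v}" "G.nbrs v \<inter> H.nbrs v = {}"
    using complement v G.irrefl H.irrefl by (auto simp: G.nbrs_def H.nbrs_def)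
  then show ?thesis
    using v G.finite_V card_Un_disjoint[OF G.finite_nbrs H.finite_nbrs, of v v]
    by (simp add: card_Diff_singleton)
qed

text \<open>A vertex missed by both would be a common neighbor of \<open>u\<close> and
  \<open>v\<close> in the complement.\<close>

lemma dominating:
  assumes "u \<in> V" "v \<in> V" "u \<noteq> v" "g u = g v" "w \<in> V" "w \<noteq> u" "w \<noteq> v"
  shows "E u w \<or> E v w"
proof (rule ccontr)
  assume "\<not> (E u w \<or> E v w)"
  then have "F u w" "F v w" using assms complement by auto
  with assms show False using H.proper[of u v w] by simp
qed

lemma dominating_degree:
  assumes "u \<in> V" "v \<in> V" "u \<noteq> v" "g u = g v"
  shows "card V \<le> card (G.nbrs u) + card (G.nbrs v) + 2"
proof -
  have "card V \<le> card ((G.nbrs u \<union> G.nbrs v) \<union> {u, v})"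
    using dominating[OF assms] by (intro card_mono) (auto simp: G.nbrs_def G.finite_V)
  also have "\<dots> \<le> card (G.nbrs u) + card (G.nbrs v) + card {u, v}"
    by (meson add_le_mono1 card_Un_le le_trans)
  finally show ?thesis using assms by simp
qed

lemma colors_large:
  assumes "l < card V"
  shows "card V \<le> 2 * k + 2"
proof -
  obtain u v where uv: "u \<in> V" "v \<in> V" "u \<noteq> v" "g u = g v"
    using H.same_color_exists[OF assms] by blast
  show ?thesis
    using dominating_degree[OF uv] G.degree_le[OF uv(1)] G.degree_le[OF uv(2)] by simp
qed

lemma few_colors_False:
  assumes kl: "k + l = card V - 1 \<and> 5 \<le> card V \<or> k + l = card V \<and> 7 \<le> card V \<and> odd (card V)"
    and le: "k \<le> l"
  shows False
proof -
  have "V \<noteq> {}" using kl by auto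
  then have "1 \<le> k" using G.color_range by fastforce
  then have "l < card V" using kl by linarith
  then have n_le: "card V \<le> 2 * k + 2" by (rule colors_large)
  \<comment> \<open>With \<open>n_le\<close> and \<open>le\<close>, parity pins down
    \<open>card V = 2 * k + 1\<close> in this case.\<close>
  have odd: "card V \<noteq> 2 * k" "card V \<noteq> 2 * k + 2" if "k + l = card V"
    using kl that by auto
  have "2 * k < card V" using kl le odd(1) by linarith
  then obtain c where c: "2 < card {v \<in> V. f v = c}"
    by (rule G.large_class_exists)
  define A where "A = {v \<in> V. f v = c}"
  have A: "A \<subseteq> V" and mono: "\<forall>u\<in>A. \<forall>v\<in>A. f u = f v"
    by (auto simp: A_def)
  have finA: "finite A" using A G.finite_V finite_subset by blast
  have deg_ge: "card V - 1 - l \<le> card (G.nbrs v)" if "v \<in> A" for v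
    using degree_sum[of v] H.degree_le[of v] that A by fastforce
  have "card A * (card V - 1 - l) \<le> card V"
    using sum_bounded_below[of A "card V - 1 - l" "\<lambda>v. card (G.nbrs v)"] deg_ge
      G.sum_degree_le[OF A mono] by fastforce
  \<comment> \<open>Here \<open>card V - 1 - l\<close> is \<open>k\<close> or \<open>k - 1\<close>,
    so a class of four would give \<open>card V \<le> 4\<close> or \<open>card V \<le> 5\<close> in
    the respective cases.\<close>
  moreover have "4 * (card V - 1 - l) \<le> card A * (card V - 1 - l)" if "4 \<le> card A"
    using that by (rule mult_le_mono1)
  ultimately have "\<not> 4 \<le> card A" using kl n_le odd by linarith
  then have "card A = 3" using c by (simp add: A_def)
  then obtain p q r where pqr: "A = {p, q, r}" "p \<noteq> q" "p \<noteq> r" "q \<noteq> r"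
    by (auto simp: card_3_iff)
  obtain x where x: "x \<in> A" and iso: "\<And>w. w \<in> A \<Longrightarrow> \<not> E x w"
    using G.isolated_in_triple[of p q r] pqr A mono by auto
  have xV: "x \<in> V" using x A by blast
  have degx: "card (G.nbrs x) < k"
    using xV x iso by (intro G.degree_less) (auto simp: A_def)
  \<comment> \<open>If \<open>k + l = card V - 1\<close>, the complement degree of \<open>x\<close>
    would exceed \<open>l\<close>; only the odd case survives, and there \<open>x\<close> attains
    \<open>l\<close>.\<close>
  then have kl_eq: "k + l = card V" and "\<not> card (H.nbrs x) < l"
    using degree_sum[OF xV] H.degree_le[OF xV] kl by linarith+
  then obtain y where y: "y \<in> V" "F x y" "g y = g x"
    using H.degree_less[OF xV xV] by blast
  have xy: "x \<noteq> y" using y H.irrefl by blast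
  have "y \<in> A"
  proof (rule ccontr)
    assume yA: "y \<notin> A"
    \<comment> \<open>Since \<open>x\<close> has no neighbor in \<open>A\<close>, domination of the
      rest of \<open>A\<close> falls to \<open>y\<close> alone, which then has two neighbors of one
      color.\<close>
    have E: "E y w" if "w \<in> A" "w \<noteq> x" for w
      using dominating[of x y w] xV y xy iso that A yA by auto
    obtain u w where "u \<in> A" "w \<in> A" "u \<noteq> w" "u \<noteq> x" "w \<noteq> x"
      using pqr x by auto
    then show False
      using E[of u] E[of w] G.proper[of u w y] G.sym mono A y(1) by blast
  qed
  then obtain z where z: "A = {x, y, z}" "z \<noteq> x" "z \<noteq> y"
    using pqr x xy by auto
  \<comment> \<open>Strictness matters: it leaves \<open>z\<close> degree at most 1, against
    \<open>k - 1 \<ge> 2\<close>. The weak bound would leave 2, no contradiction for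
    \<open>card V = 7\<close>.\<close>
  have "(\<Sum>v\<in>A. card (G.nbrs v)) < card V"
    using iso by (intro G.sum_degree_less[OF A mono xV])
  then have "card (G.nbrs x) + card (G.nbrs y) + card (G.nbrs z) < card V"
    using z xy by simp
  moreover have "card V \<le> card (G.nbrs x) + card (G.nbrs y) + 2"
    using dominating_degree[of x y] xV y xy by simp
  ultimately show False
    using deg_ge[of z] z(1) kl kl_eq n_le by simp linarith
qed

text \<open>Makes \<open>k \<le> l\<close> no loss of generality.\<close>

lemma swap: "injectively_colored_pair V F E g f l k"
  by unfold_locales (simp add: complement)

text \<open>The degree sum at a single vertex gives \<open>card V - 1 \<le> k + l\<close>, so only
  the exact values refuted by \<open>few_colors_False\<close> remain.\<close>

lemma colors_sum_ge:
  assumes "5 \<le> card V"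
  shows "card V \<le> k + l" and "7 \<le> card V \<Longrightarrow> odd (card V) \<Longrightarrow> card V + 1 \<le> k + l"
proof -
  obtain v where v: "v \<in> V" using assms by fastforce
  have ge: "card V - 1 \<le> k + l"
    using degree_sum[OF v] G.degree_le[OF v] H.degree_le[OF v] by linarith
  have no: False
    if "k + l = card V - 1 \<and> 5 \<le> card V \<or> k + l = card V \<and> 7 \<le> card V \<and> odd (card V)"
  proof (cases "k \<le> l")
    case True
    with that show False by (rule few_colors_False)
  next
    case False
    with that show False
      by (intro injectively_colored_pair.few_colors_False[OF swap]) auto
  qed
  show *: "card V \<le> k + l" using no ge assms by (cases "k + l = card V - 1") auto
  show "card V + 1 \<le> k + l" if "7 \<le> card V" "odd (card V)"
    using no * that by (cases "k + l = card V") auto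
qed

end

section \<open>Transfer to injective chromatic numbers\<close>

lemma injective_chromatic_number_coloring:
  assumes "finite (pverts G)"
  obtains f where "injective_coloring G (injective_chromatic_number G) f"
proof -
  have "\<exists>f. injective_coloring G (injective_chromatic_number G) f"
    unfolding injective_chromatic_number_def
    by (rule LeastI_ex) (rule exI, rule injective_coloring_exists[OF assms])
  with that show thesis by blast
qed

text \<open>Distinct colors on all vertices are always admissible; applied to both graphs, this is
  the upper bound \<open>2 * n\<close>.\<close>

lemma injective_chromatic_number_le:
  assumes "finite (pverts G)"
  shows "injective_chromatic_number G \<le> card (pverts G)"
  unfolding injective_chromatic_number_def
  by (rule Least_le) (rule injective_coloring_exists[OF assms])

lemma injectively_colored_graph_arcs:
  assumes "pair_graph G" and f: "injective_coloring G k f"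
  shows "injectively_colored_graph (pverts G) (\<lambda>u v. (u, v) \<in> parcs G) f k"
proof -
  interpret pair_graph G by (rule assms)
  show ?thesis
  proof
    show "(u, v) \<in> parcs G \<Longrightarrow> (v, u) \<in> parcs G" for u v
      by (rule arcs_symmetric)
    show "(v, v) \<notin> parcs G" for v
      using no_loops' by blast
    show "finite (pverts G)" by simp
    show "f v \<in> {1..k}" if "v \<in> pverts G" for v
      using f that unfolding injective_coloring_def by blast
    show "u = v" if "u \<in> pverts G" "v \<in> pverts G" "w \<in> pverts G" "(u, w) \<in> parcs G"
      "(v, w) \<in> parcs G" "f u = f v" for u v w
      using f that unfolding injective_coloring_def common_neighbor_def by blast
  qed
qed

theorem theorem6:
  fixes G :: "'a pair_pre_digraph" and n :: nat
  assumes "pair_graph G"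
    and "card (pverts G) = n"
    and "n \<ge> 5"
  shows "(n = 5 \<or> even n \<longrightarrow>
            n \<le> injective_chromatic_number G + injective_chromatic_number (complement_graph G) \<and>
            injective_chromatic_number G + injective_chromatic_number (complement_graph G) \<le> 2 * n) \<and>
         (n \<ge> 7 \<and> odd n \<longrightarrow>
            n + 1 \<le> injective_chromatic_number G + injective_chromatic_number (complement_graph G) \<and>
            injective_chromatic_number G + injective_chromatic_number (complement_graph G) \<le> 2 * n)"
proof -
  let ?H = "complement_graph G"
  interpret pair_graph G by (rule assms)
  have H: "pair_graph ?H" by (rule pair_graph_complement_graph[OF assms(1)])
  have verts: "pverts ?H = pverts G" by (simp add: complement_graph_def)
  have fin: "finite (pverts G)" "finite (pverts ?H)" using verts by auto
  obtain f where f: "injective_coloring G (injective_chromatic_number G) f"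
    using injective_chromatic_number_coloring[OF fin(1)] .
  obtain g where g: "injective_coloring ?H (injective_chromatic_number ?H) g"
    using injective_chromatic_number_coloring[OF fin(2)] .
  interpret injectively_colored_pair "pverts G" "\<lambda>u v. (u, v) \<in> parcs G" "\<lambda>u v. (u, v) \<in> parcs ?H"
    f g "injective_chromatic_number G" "injective_chromatic_number ?H"
  proof (intro injectively_colored_pair.intro injectively_colored_pair_axioms.intro)
    show "injectively_colored_graph (pverts G) (\<lambda>u v. (u, v) \<in> parcs G) f
        (injective_chromatic_number G)"
      using injectively_colored_graph_arcs[OF assms(1) f] .
    show "injectively_colored_graph (pverts G) (\<lambda>u v. (u, v) \<in> parcs ?H) g
        (injective_chromatic_number ?H)"
      using injectively_colored_graph_arcs[OF H g] unfolding verts .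
  qed (simp add: complement_graph_def)
  show ?thesis
    using colors_sum_ge[unfolded assms(2), OF assms(3)] injective_chromatic_number_le[OF fin(1)]
      injective_chromatic_number_le[OF fin(2)]
    unfolding verts assms(2) by linarith
qed

end
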